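(* Let $\mathcal{H}_n$ be an $n$-dimensional Hilbert space, let $K$ be a linear operator on $\mathcal{H}_n$, and let $F=\{f_i\}_{i\in I_m}$ be a $K$-frame of $\mathcal{H}_n$. Then the following hold. (i) If $F\subseteq R(K)$ (i.e. $f_i\in R(K)$ for all $i\in I_m$), then $\{K^{*}(S_F|_{R(K)})^{-1}\pi_{S_F(R(K))}f_i\}_{i\in I_m}$ is the canonical $K$-dual of $F$. (ii) If either $R(K)\subseteq S_F(R(K))$ or $F\subseteq S_F(R(K))$, then $\{K^{*}((S_F|_{R(K)})^{-1})^{*}\pi_{R(K)}f_i\}_{i\in I_m}$ is the canonical $K$-dual of $F$.
   Context: $I_m=\{1,\dots,m\}$; $\{\delta_i\}_{i\in I_m}$ is the standard orthonormal basis of $l^2(I_m)=\mathbb{C}^m$; $R(T)$ denotes range and $N(T)$ kernel; inner products are linear in the first variable. For a sequence $F=\{f_i\}_{i\in I_m}\subseteq\mathcal{H}_n$, the synthesis operator is $\theta_F:l^2(I_m)\to\mathcal{H}_n$, $\theta_F\{c_i\}=\sum_i c_if_i$, the analysis operator is $\theta_F^{*}f=\{\langle f,f_i\rangle\}_i$, and $S_F=\theta_F\theta_F^{*}$. $F$ is a $K$-frame if $R(K)\subseteq R(\theta_F)=\mathrm{span}\{f_i\}$. A sequence $G=\{g_i\}_{i\in I_m}\subseteq\mathcal{H}_n$ is a $K$-dual of $F$ if $\theta_F\theta_G^{*}=K$, i.e. $Kf=\sum_i\langle f,g_i\rangle f_i$ for all $f\in\mathcal{H}_n$. For a $K$-frame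 $F$, Douglas' theorem gives a unique operator $X_F:\mathcal{H}_n\to l^2(I_m)$ with $\theta_FX_F=K$ and $R(X_F)\subseteq R(\theta_F^{*})$ (it also satisfies $N(X_F)=N(K)$ and $\|X_F\|^2=\inf\{\alpha>0: \|K^{*}f\|^2\le\alpha\|\theta_F^{*}f\|^2\ \forall f\in\mathcal{H}_n\}$); the canonical $K$-dual of $F$ is the $K$-dual $\{X_F^{*}\delta_i\}_{i\in I_m}$. For a $K$-frame $F$, the restriction $S_F|_{R(K)}:R(K)\to S_F(R(K))$ is invertible; its inverse is $(S_F|_{R(K)})^{-1}:S_F(R(K))\to R(K)$, and $((S_F|_{R(K)})^{-1})^{*}:R(K)\to S_F(R(K))$ is the Hilbert space adjoint of that inverse. $\pi_V$ is the orthogonal projection of $\mathcal{H}_n$ onto the subspace $V$. *)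

theory Defs
  imports "HOL-Analysis.Analysis"
begin

class complex_vector = ab_group_add +
  fixes scaleC :: "complex \<Rightarrow> 'a \<Rightarrow> 'a"  (infixr "*\<^sub>C" 75)
  assumes scaleC_add_right: "a *\<^sub>C (x + y) = a *\<^sub>C x + a *\<^sub>C y"
    and scaleC_add_left: "(a + b) *\<^sub>C x = a *\<^sub>C x + b *\<^sub>C x"
    and scaleC_scaleC: "a *\<^sub>C b *\<^sub>C x = (a * b) *\<^sub>C x"
    and scaleC_one: "1 *\<^sub>C x = x"

global_interpretation complex_vector:
  vector_space "scaleC :: complex \<Rightarrow> 'a \<Rightarrow> 'a::complex_vector"
  by unfold_locales
    (simp_all add: scaleC_add_right scaleC_add_left scaleC_scaleC scaleC_one)

abbreviation clinear :: "('a::complex_vector \<Rightarrow> 'b::complex_vector) \<Rightarrow> bool"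
  where "clinear \<equiv> Vector_Spaces.linear scaleC scaleC"

(* The inner product is linear in the first variable.  Completeness is not an axiom:
   the spaces considered below are finite-dimensional, hence automatically complete. *)
class complex_inner = complex_vector +
  fixes cinner :: "'a \<Rightarrow> 'a \<Rightarrow> complex"
  assumes cinner_commute: "cinner x y = cnj (cinner y x)"
    and cinner_add_left: "cinner (x + y) z = cinner x z + cinner y z"
    and cinner_scaleC_left: "cinner (a *\<^sub>C x) y = a * cinner x y"
    and cinner_ge_zero: "0 \<le> Re (cinner x x)"
    and cinner_eq_zero_iff: "cinner x x = 0 \<longleftrightarrow> x = 0"

instantiation complex :: complex_inner
begin

definition scaleC_complex :: "complex \<Rightarrow> complex \<Rightarrow> complex"
  where "scaleC_complex a x = a * x"

definition cinner_complex :: "complex \<Rightarrow> complex \<Rightarrow> complex"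
  where "cinner_complex x y = x * cnj y"

instance
  by standard (auto simp: scaleC_complex_def cinner_complex_def algebra_simps)

end

lemma cinner_self_Im: "Im (cinner x x) = 0" for x :: "'a::complex_inner"
  using cinner_commute[of x x] by (metis Reals_cnj_iff complex_is_Real_iff)

instantiation vec :: (complex_inner, finite) complex_inner
begin

definition scaleC_vec :: "complex \<Rightarrow> 'a ^ 'b \<Rightarrow> 'a ^ 'b"
  where "scaleC_vec a x = (\<chi> i. a *\<^sub>C (x $ i))"

definition cinner_vec :: "'a ^ 'b \<Rightarrow> 'a ^ 'b \<Rightarrow> complex"
  where "cinner_vec x y = (\<Sum>i\<in>UNIV. cinner (x $ i) (y $ i))"

instance
proof
  fix a b :: complex and x y z :: "'a ^ 'b"
  show "a *\<^sub>C (x + y) = a *\<^sub>C x + a *\<^sub>C y"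
    "(a + b) *\<^sub>C x = a *\<^sub>C x + b *\<^sub>C x"
    "a *\<^sub>C b *\<^sub>C x = (a * b) *\<^sub>C x" "1 *\<^sub>C x = x"
    by (simp_all add: vec_eq_iff scaleC_vec_def scaleC_add_right scaleC_add_left
        scaleC_scaleC scaleC_one)
  show "cinner x y = cnj (cinner y x)"
    unfolding cinner_vec_def cnj_sum by (rule sum.cong[OF refl]) (rule cinner_commute)
  show "cinner (x + y) z = cinner x z + cinner y z"
    by (simp add: cinner_vec_def cinner_add_left sum.distrib)
  show "cinner (a *\<^sub>C x) y = a * cinner x y"
    by (simp add: cinner_vec_def scaleC_vec_def cinner_scaleC_left sum_distrib_left)
  show "0 \<le> Re (cinner x x)"
    by (simp add: cinner_vec_def cinner_ge_zero sum_nonneg)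
  show "cinner x x = 0 \<longleftrightarrow> x = 0"
  proof
    assume "cinner x x = 0"
    then have "(\<Sum>i\<in>UNIV. Re (cinner (x $ i) (x $ i))) = 0"
      unfolding cinner_vec_def by (metis Re_sum zero_complex.sel(1))
    then have "Re (cinner (x $ i) (x $ i)) = 0" for i
      by (simp add: sum_nonneg_eq_0_iff cinner_ge_zero)
    then have "cinner (x $ i) (x $ i) = 0" for i
      by (simp add: complex_eq_iff cinner_self_Im)
    then show "x = 0"
      by (simp add: vec_eq_iff cinner_eq_zero_iff)
  next
    assume "x = 0"
    moreover have "cinner (0::'a) 0 = 0"
      by (simp add: cinner_eq_zero_iff)
    ultimately show "cinner x x = 0"
      by (simp add: cinner_vec_def)
  qed
qed

end

(* The adjoint of a linear map T from the subspace V to a subspace W.  W does not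
   enter the formula: it only says at which arguments w the adjoint is used. *)
definition cadjoint_on ::
    "'a::complex_inner set \<Rightarrow> ('a \<Rightarrow> 'b::complex_inner) \<Rightarrow> 'b \<Rightarrow> 'a"
  where "cadjoint_on V T w = (THE v. v \<in> V \<and> (\<forall>u\<in>V. cinner (T u) w = cinner u v))"

abbreviation cadjoint :: "('a::complex_inner \<Rightarrow> 'b::complex_inner) \<Rightarrow> 'b \<Rightarrow> 'a"
  where "cadjoint \<equiv> cadjoint_on UNIV"

definition orth_proj :: "'a::complex_inner set \<Rightarrow> 'a \<Rightarrow> 'a"
  where "orth_proj V x = (THE v. v \<in> V \<and> (\<forall>w\<in>V. cinner (x - v) w = 0))"

(* A sequence of m vectors is a family indexed by a finite type 'm with m elements,
   and l^2(I_m) is complex ^ 'm. *)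

definition synthesis :: "('m::finite \<Rightarrow> 'a::complex_inner) \<Rightarrow> complex ^ 'm \<Rightarrow> 'a"
  where "synthesis F c = (\<Sum>i\<in>UNIV. (c $ i) *\<^sub>C F i)"

definition analysis :: "('m::finite \<Rightarrow> 'a::complex_inner) \<Rightarrow> 'a \<Rightarrow> complex ^ 'm"
  where "analysis F f = (\<chi> i. cinner f (F i))"

definition frame_op :: "('m::finite \<Rightarrow> 'a::complex_inner) \<Rightarrow> 'a \<Rightarrow> 'a"
  where "frame_op F = synthesis F \<circ> analysis F"

definition K_frame :: "('a::complex_inner \<Rightarrow> 'a) \<Rightarrow> ('m::finite \<Rightarrow> 'a) \<Rightarrow> bool"
  where "K_frame K F \<longleftrightarrow> range K \<subseteq> range (synthesis F)"

definition K_dual ::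
    "('a::complex_inner \<Rightarrow> 'a) \<Rightarrow> ('m::finite \<Rightarrow> 'a) \<Rightarrow> ('m \<Rightarrow> 'a) \<Rightarrow> bool"
  where "K_dual K F G \<longleftrightarrow> synthesis F \<circ> analysis G = K"

(* The Douglas solution X_F. *)
definition douglas_op ::
    "('a::complex_inner \<Rightarrow> 'a) \<Rightarrow> ('m::finite \<Rightarrow> 'a) \<Rightarrow> 'a \<Rightarrow> complex ^ 'm"
  where "douglas_op K F =
    (THE X. clinear X \<and> synthesis F \<circ> X = K \<and> range X \<subseteq> range (analysis F))"

(* "axis i 1" is the standard basis vector delta_i. *)
definition canonical_K_dual ::
    "('a::complex_inner \<Rightarrow> 'a) \<Rightarrow> ('m::finite \<Rightarrow> 'a) \<Rightarrow> ('m \<Rightarrow> 'a) \<Rightarrow> bool"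
  where "canonical_K_dual K F G \<longleftrightarrow>
    K_dual K F G \<and> (\<forall>i. G i = cadjoint (douglas_op K F) (axis i 1))"

lemma cinner_right_eqI:
  fixes x y :: "'a::complex_inner"
  assumes "\<And>u. cinner u x = cinner u y"
  shows "x = y"
proof -
  have "cinner (x - y) x = cinner (x - y) y" by (rule assms)
  then have "cinner x (x - y) = cinner y (x - y)"
    by (metis cinner_commute)
  moreover have "cinner x (x - y) = cinner (x - y) (x - y) + cinner y (x - y)"
    by (metis cinner_add_left diff_add_cancel)
  ultimately have "cinner (x - y) (x - y) = 0" by simp
  then show "x = y" by (simp add: cinner_eq_zero_iff)
qed

lemma cinner_sum_left:
  "cinner (\<Sum>i\<in>A. g i) (y::'a::complex_inner) = (\<Sum>i\<in>A. cinner (g i) y)"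
proof -
  have "cinner 0 y = 0" using cinner_add_left[of 0 0 y] by simp
  then show ?thesis
    by (induction A rule: infinite_finite_induct) (auto simp: cinner_add_left)
qed

lemma cadjoint_synthesis: "cadjoint (synthesis F) = analysis F"
proof
  fix f
  have *: "cinner (synthesis F c) f = cinner c (analysis F f)" for c
    unfolding synthesis_def cinner_sum_left cinner_vec_def analysis_def
    by (rule sum.cong[OF refl])
      (simp add: cinner_scaleC_left cinner_complex_def, metis cinner_commute)
  show "cadjoint (synthesis F) f = analysis F f"
    unfolding cadjoint_on_def
    by (rule the_equality) (auto simp: * intro: cinner_right_eqI)
qed

end

theory Submission
  imports Defs
begin

text \<open>In each of the three cases a dimension count gives \<open>S(R) = R\<close>, where \<open>R = R(K)\<close> and \<open>S = S\<^sub>F\<close>.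
  Then the inverse \<open>A\<close> of \<open>S\<close> restricted to \<open>R\<close> is self-adjoint, so both formulas name the family
  \<open>g\<^sub>i = K* A \<pi>\<^sub>R f\<^sub>i\<close>. Moving \<open>K*\<close>, \<open>A\<close> and \<open>\<pi>\<^sub>R\<close> across the inner product shows that its analysis
  operator is \<open>\<theta>\<^sub>F* A K\<close>. This has range in \<open>R(\<theta>\<^sub>F*)\<close>, and composing it with \<open>\<theta>\<^sub>F\<close> gives \<open>S A K = K\<close>,
  so it is the Douglas solution.\<close>

lemma cinner_zero_left [simp]: "cinner 0 (x::'a::complex_inner) = 0"
  using cinner_add_left[of 0 0 x] by simp

lemma cinner_zero_right [simp]: "cinner (x::'a::complex_inner) 0 = 0"
  by (subst cinner_commute) simp

lemma cinner_add_right: "cinner (x::'a::complex_inner) (y + z) = cinner x y + cinner x z"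
  by (metis cinner_add_left cinner_commute complex_cnj_add)

lemma cinner_scaleC_right: "cinner (x::'a::complex_inner) (a *\<^sub>C y) = cnj a * cinner x y"
  by (metis cinner_commute cinner_scaleC_left complex_cnj_mult)

lemma cinner_diff_left: "cinner (x - y) (z::'a::complex_inner) = cinner x z - cinner y z"
  by (metis cinner_add_left diff_add_cancel add_diff_cancel_right')

lemma cinner_diff_right: "cinner (x::'a::complex_inner) (y - z) = cinner x y - cinner x z"
  by (metis cinner_add_right diff_add_cancel add_diff_cancel_right')

lemma clinear_iff:
  fixes f :: "'a::complex_vector \<Rightarrow> 'b::complex_vector"
  shows "clinear f \<longleftrightarrow> (\<forall>x y. f (x + y) = f x + f y) \<and> (\<forall>c x. f (c *\<^sub>C x) = c *\<^sub>C f x)"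
  unfolding Vector_Spaces.linear_iff
  by (simp add: complex_vector.vector_space_axioms)

lemma clinear_synthesis: "clinear (synthesis F)"
  by (simp add: clinear_iff synthesis_def scaleC_vec_def scaleC_complex_def scaleC_add_left
      sum.distrib complex_vector.scale_sum_right scaleC_scaleC)

lemma clinear_analysis: "clinear (analysis F)"
  by (simp add: clinear_iff analysis_def vec_eq_iff scaleC_vec_def scaleC_complex_def
      cinner_add_left cinner_scaleC_left)

lemma clinear_frame_op: "clinear (frame_op F)"
  unfolding frame_op_def
  by (rule Vector_Spaces.linear_compose[OF clinear_analysis clinear_synthesis])

lemma cinner_synthesis: "cinner (synthesis F c) f = cinner c (analysis F f)"
  unfolding synthesis_def cinner_sum_left cinner_vec_def analysis_def
  by (rule sum.cong[OF refl])
    (simp add: cinner_scaleC_left cinner_complex_def, metis cinner_commute)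

lemma cinner_analysis: "cinner (analysis F f) c = cinner f (synthesis F c)"
  by (metis cinner_synthesis cinner_commute)

lemma cinner_frame_op: "cinner (frame_op F x) y = cinner x (frame_op F y)"
  by (simp add: frame_op_def cinner_synthesis cinner_analysis)

lemma synthesis_axis: "synthesis F (axis i 1) = F i"
proof -
  have "synthesis F (axis i 1) = (\<Sum>j\<in>UNIV. if j = i then F j else 0)"
    unfolding synthesis_def by (rule sum.cong) (auto simp: axis_def scaleC_one)
  then show ?thesis by simp
qed

text \<open>By adjointness, \<open>cinner (analysis F x) (analysis F x)\<close> equals
  \<open>cinner x (synthesis F (analysis F x))\<close>.\<close>

lemma analysis_eq_0I:
  assumes "synthesis F (analysis F x) = 0"
  shows "analysis F x = 0"
  by (metis assms cinner_analysis cinner_eq_zero_iff cinner_zero_right)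

text \<open>A difference killed by \<open>frame_op F\<close> is killed by \<open>analysis F\<close>,
  hence orthogonal to the range of \<open>synthesis F\<close>; lying in that range, it is orthogonal
  to itself.\<close>

lemma inj_on_frame_op: "inj_on (frame_op F) (range (synthesis F))"
proof (rule inj_onI)
  fix x y assume "x \<in> range (synthesis F)" "y \<in> range (synthesis F)"
    and eq: "frame_op F x = frame_op F y"
  then obtain c d where xy: "x = synthesis F c" "y = synthesis F d" by auto
  interpret S: Vector_Spaces.linear scaleC scaleC "frame_op F" by (rule clinear_frame_op)
  interpret T: Vector_Spaces.linear scaleC scaleC "synthesis F" by (rule clinear_synthesis)
  have "frame_op F (x - y) = 0" using eq by (simp add: S.diff)
  then have "analysis F (x - y) = 0" by (intro analysis_eq_0I) (simp add: frame_op_def)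
  then have "cinner (synthesis F (c - d)) (x - y) = 0" by (simp add: cinner_synthesis)
  then have "cinner (x - y) (x - y) = 0" by (simp add: xy T.diff)
  then show "x = y" by (simp add: cinner_eq_zero_iff)
qed

text \<open>Supplies existence for the \<open>THE\<close> in \<open>orth_proj\<close> and
  \<open>cadjoint_on\<close>. The induction is Gram-Schmidt; \<open>\<phi>\<close> stays arbitrary
  because the induction hypothesis serves two functionals, \<open>\<phi>\<close> itself and the
  pairing with the new vector.\<close>

lemma riesz_span:
  fixes B :: "'a::complex_inner set" and \<phi> :: "'a \<Rightarrow> complex"
  assumes "finite B" "clinear \<phi>"
  shows "\<exists>v\<in>complex_vector.span B. \<forall>u\<in>complex_vector.span B. \<phi> u = cinner u v"
  using assms
proof (induction arbitrary: \<phi> rule: finite_induct)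
  case empty
  then show ?case by (auto simp: clinear_iff) (metis add_cancel_right_right)
next
  case (insert b B)
  note span = complex_vector.span_add complex_vector.span_diff complex_vector.span_scale
  have mono: "u \<in> complex_vector.span (insert b B)" if "u \<in> complex_vector.span B" for u
    using that complex_vector.span_mono[of B "insert b B"] by auto
  \<comment> \<open>Representing this functional on the span of \<open>B\<close> yields
    \<open>p\<close>, the orthogonal projection of \<open>b\<close>; the residual
    \<open>e = b - p\<close> is then orthogonal to that span.\<close>
  have "clinear (\<lambda>u. cinner u b)"
    by (simp add: clinear_iff cinner_add_left cinner_scaleC_left scaleC_complex_def)
  then obtain p where p: "p \<in> complex_vector.span B"
    "\<And>u. u \<in> complex_vector.span B \<Longrightarrow> cinner u b = cinner u p"
    using insert.IH by blast
  define e where "e = b - p"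
  have e: "cinner u e = 0" "cinner e u = 0" if "u \<in> complex_vector.span B" for u
  proof -
    show "cinner u e = 0" using p(2)[OF that] by (simp add: e_def cinner_diff_right)
    then show "cinner e u = 0" by (subst cinner_commute) simp
  qed
  obtain w where w: "w \<in> complex_vector.span B"
    "\<And>u. u \<in> complex_vector.span B \<Longrightarrow> \<phi> u = cinner u w"
    using insert.IH insert.prems by blast
  have \<phi>: "\<phi> (x + y) = \<phi> x + \<phi> y" "\<phi> (c *\<^sub>C x) = c * \<phi> x" for x y c
    using insert.prems unfolding clinear_iff by (simp_all add: scaleC_complex_def)
  have \<phi>0: "\<phi> 0 = 0" using \<phi>(1)[of 0 0] by simp
  \<comment> \<open>The coefficient makes \<open>cinner e v = \<phi> e\<close>; it is conjugated
    because \<open>cinner\<close> is conjugate-linear in its second argument. If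
    \<open>e = 0\<close>, the quotient is 0 by convention and both sides vanish.\<close>
  define v where "v = w + cnj (\<phi> e / cinner e e) *\<^sub>C e"
  have e_in: "e \<in> complex_vector.span (insert b B)"
    unfolding e_def by (intro span mono p complex_vector.span_base) simp
  have "\<phi> u = cinner u v" if u_in: "u \<in> complex_vector.span (insert b B)" for u
  proof -
    obtain k where "u - k *\<^sub>C b \<in> complex_vector.span B"
      using u_in unfolding complex_vector.span_breakdown_eq by blast
    then have "u - k *\<^sub>C b + k *\<^sub>C p \<in> complex_vector.span B"
      using p(1) by (intro complex_vector.span_add complex_vector.span_scale)
    \<comment> \<open>Replacing \<open>b\<close> by \<open>p + e\<close> splits \<open>u\<close>
      into a part in the span of \<open>B\<close> and a multiple of \<open>e\<close>, so the
      representation need only be checked on these two.\<close>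
    moreover define u' where "u' = u - k *\<^sub>C b + k *\<^sub>C p"
    ultimately have u': "u' \<in> complex_vector.span B" by simp
    have u: "u = u' + k *\<^sub>C e"
      by (simp add: u'_def e_def complex_vector.scale_right_diff_distrib)
    have "\<phi> e = cinner e v"
      by (cases "e = 0") (simp_all add: v_def e w \<phi>0 cinner_add_right
          cinner_scaleC_right cinner_eq_zero_iff)
    moreover have "\<phi> u' = cinner u' v"
      using u' by (simp add: v_def e w cinner_add_right cinner_scaleC_right)
    ultimately show ?thesis
      by (simp add: u \<phi> cinner_add_left cinner_scaleC_left)
  qed
  moreover have "v \<in> complex_vector.span (insert b B)"
    unfolding v_def by (intro span mono w e_in)
  ultimately show ?case by blast
qed

lemma orth_proj_eqI:
  assumes V: "complex_vector.subspace V" and "v \<in> V" "\<And>w. w \<in> V \<Longrightarrow> cinner (x - v) w = 0"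
  shows "orth_proj V x = v"
  unfolding orth_proj_def
proof (rule the_equality)
  fix v' assume v': "v' \<in> V \<and> (\<forall>w\<in>V. cinner (x - v') w = 0)"
  then have "v' - v \<in> V" using assms by (simp add: complex_vector.subspace_diff)
  \<comment> \<open>Both residuals are orthogonal to \<open>v' - v\<close>, hence so is their
    difference, which is \<open>v' - v\<close> itself.\<close>
  then have "cinner (x - v) (v' - v) - cinner (x - v') (v' - v) = 0"
    using assms v' by simp
  then have "cinner (v' - v) (v' - v) = 0"
    by (simp flip: cinner_diff_left)
  then show "v' = v" by (simp add: cinner_eq_zero_iff)
qed (use assms in auto)

lemma orth_proj_works:
  fixes x :: "'a::complex_inner"
  assumes "finite B" "complex_vector.span B = V"
  shows "orth_proj V x \<in> V" "w \<in> V \<Longrightarrow> cinner w (orth_proj V x) = cinner w x"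
proof -
  have "clinear (\<lambda>u. cinner u x)"
    by (simp add: clinear_iff cinner_add_left cinner_scaleC_left scaleC_complex_def)
  from riesz_span[OF assms(1) this] obtain v where
    v: "v \<in> V" "\<And>u. u \<in> V \<Longrightarrow> cinner u x = cinner u v"
    using assms(2) by auto
  have "orth_proj V x = v"
  proof (rule orth_proj_eqI)
    show "complex_vector.subspace V" using assms(2) complex_vector.subspace_span by blast
    fix w assume "w \<in> V"
    from v(2)[OF this] have "cinner w (x - v) = 0" by (simp add: cinner_diff_right)
    then show "cinner (x - v) w = 0" by (subst cinner_commute) simp
  qed (rule v)
  then show "orth_proj V x \<in> V" "w \<in> V \<Longrightarrow> cinner w (orth_proj V x) = cinner w x"
    using v by simp_all
qed

lemma cadjoint_on_eqI:
  assumes V: "complex_vector.subspace V" and "v \<in> V"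
    and "\<And>u. u \<in> V \<Longrightarrow> cinner (T u) w = cinner u v"
  shows "cadjoint_on V T w = v"
  unfolding cadjoint_on_def
proof (rule the_equality)
  fix v' assume v': "v' \<in> V \<and> (\<forall>u\<in>V. cinner (T u) w = cinner u v')"
  then have "v' - v \<in> V" using assms by (simp add: complex_vector.subspace_diff)
  then have "cinner (v' - v) (v' - v) = 0"
    using assms(3) v' by (simp add: cinner_diff_right)
  then show "v' = v" by (simp add: cinner_eq_zero_iff)
qed (use assms in auto)

lemma cinner_cadjoint:
  fixes T :: "'a::complex_inner \<Rightarrow> 'b::complex_inner"
  assumes "finite B" "complex_vector.span B = (UNIV :: 'a set)" "clinear T"
  shows "cinner u (cadjoint T w) = cinner (T u) w"
proof -
  have "clinear (\<lambda>u. cinner (T u) w)"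
    using assms(3) by (simp add: clinear_iff cinner_add_left cinner_scaleC_left scaleC_complex_def)
  from riesz_span[OF assms(1) this] obtain v where "\<And>u. cinner (T u) w = cinner u v"
    using assms(2) by auto
  then show ?thesis
    using cadjoint_on_eqI[OF complex_vector.subspace_UNIV, of v T w] by simp
qed

text \<open>The assumptions make \<open>analysis G\<close> a Douglas solution, so only uniqueness
  remains: two solutions differ by a vector in the range of \<open>analysis F\<close> and the kernel
  of \<open>synthesis F\<close>, which meet only in 0.\<close>

lemma canonical_K_dualI:
  assumes dual: "K_dual K F G" and range: "range (analysis G) \<subseteq> range (analysis F)"
  shows "canonical_K_dual K F G"
proof -
  have "douglas_op K F = analysis G"
    unfolding douglas_op_def
  proof (rule the_equality)
    fix X assume X: "clinear X \<and> synthesis F \<circ> X = K \<and> range X \<subseteq> range (analysis F)"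
    interpret T: Vector_Spaces.linear scaleC scaleC "synthesis F" by (rule clinear_synthesis)
    interpret A: Vector_Spaces.linear scaleC scaleC "analysis F" by (rule clinear_analysis)
    show "X = analysis G"
    proof
      fix f
      obtain h where h: "X f - analysis G f = analysis F h"
        using X range by (metis A.diff rangeE range_subsetD)
      have "synthesis F (X f) = synthesis F (analysis G f)"
        using X dual by (metis K_dual_def comp_apply)
      then have "synthesis F (analysis F h) = 0" by (simp flip: h add: T.diff)
      then show "X f = analysis G f" using analysis_eq_0I[of F h] h by simp
    qed
  qed (use assms in \<open>auto simp: K_dual_def clinear_analysis\<close>)
  \<comment> \<open>The adjoint of \<open>analysis G\<close> is \<open>synthesis G\<close>, which
    sends the standard basis vector to \<open>G i\<close>.\<close>
  moreover have "cadjoint (analysis G) (axis i 1) = G i" for i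
    by (rule cadjoint_on_eqI) (simp_all add: cinner_analysis synthesis_axis)
  ultimately show ?thesis using dual by (simp add: canonical_K_dual_def)
qed

lemma canonical_K_dual_if_invariant:
  fixes K :: "'h::complex_inner \<Rightarrow> 'h" and F :: "'m::finite \<Rightarrow> 'h"
  assumes B: "finite B" "complex_vector.span B = (UNIV :: 'h set)"
    and lin: "clinear K" and inv: "frame_op F ` range K = range K"
  defines "A \<equiv> inv_into (range K) (frame_op F)"
  shows "canonical_K_dual K F (\<lambda>i. cadjoint K (A (orth_proj (range K) (F i))))"
    and "canonical_K_dual K F
      (\<lambda>i. cadjoint K (cadjoint_on (range K) A (orth_proj (range K) (F i))))"
proof -
  interpret K: Vector_Spaces.linear scaleC scaleC K by (rule lin)
  have span: "complex_vector.span (K ` B) = range K"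
    using K.span_image[of B] B(2) by simp
  have sub: "complex_vector.subspace (range K)"
    using span complex_vector.subspace_span by metis
  note proj = orth_proj_works[OF finite_imageI[OF B(1)] span]
  have A: "A w \<in> range K" "frame_op F (A w) = w" if "w \<in> range K" for w
    using that inv by (auto simp: A_def inv_into_into f_inv_into_f)
  \<comment> \<open>Write \<open>u\<close> and \<open>w\<close> as \<open>frame_op F\<close> applied
    to \<open>A u\<close> and \<open>A w\<close>, and use that \<open>frame_op F\<close> is
    symmetric.\<close>
  have selfadj: "cinner (A u) w = cinner u (A w)" if "u \<in> range K" "w \<in> range K" for u w
    by (metis A(2) cinner_frame_op that)
  let ?G = "\<lambda>i. cadjoint K (A (orth_proj (range K) (F i)))"
  have an: "analysis ?G f = analysis F (A (K f))" for f
    using A(1) selfadj proj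
    by (simp add: analysis_def cinner_cadjoint[OF B lin] flip: selfadj)
  show "canonical_K_dual K F ?G"
  proof (rule canonical_K_dualI)
    show "K_dual K F ?G"
      using A(2) by (auto simp: K_dual_def fun_eq_iff an frame_op_def)
  qed (auto simp: an)
  moreover have "cadjoint_on (range K) A w = A w" if "w \<in> range K" for w
    using that by (intro cadjoint_on_eqI sub A(1) selfadj)
  ultimately show "canonical_K_dual K F
      (\<lambda>i. cadjoint K (cadjoint_on (range K) A (orth_proj (range K) (F i))))"
    using proj(1) by simp
qed

theorem theorem3p3:
  fixes K :: "'h::complex_inner \<Rightarrow> 'h"
    and F :: "'m::finite \<Rightarrow> 'h"
    and n :: nat
  assumes dim: "\<exists>B::'h set. finite B \<and> card B = n \<and>
        complex_vector.independent B \<and> complex_vector.span B = UNIV"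
    and lin: "clinear K"
    and frame: "K_frame K F"
  shows "(range F \<subseteq> range K \<longrightarrow>
      canonical_K_dual K F
        (\<lambda>i. cadjoint K
          (inv_into (range K) (frame_op F) (orth_proj (frame_op F ` range K) (F i)))))
    \<and> (range K \<subseteq> frame_op F ` range K \<or> range F \<subseteq> frame_op F ` range K \<longrightarrow>
      canonical_K_dual K F
        (\<lambda>i. cadjoint K
          (cadjoint_on (frame_op F ` range K) (inv_into (range K) (frame_op F))
            (orth_proj (range K) (F i)))))"
proof -
  obtain B :: "'h set" where B: "finite B" "complex_vector.independent B"
    "complex_vector.span B = UNIV"
    using dim by blast
  interpret fd: finite_dimensional_vector_space "scaleC :: complex \<Rightarrow> 'h \<Rightarrow> 'h" B
    by unfold_locales (use B in auto)
  interpret pair: finite_dimensional_vector_space_pair_1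
    "scaleC :: complex \<Rightarrow> 'h \<Rightarrow> 'h" B "scaleC :: complex \<Rightarrow> 'h \<Rightarrow> 'h"
    by unfold_locales
  interpret K: Vector_Spaces.linear scaleC scaleC K by (rule lin)
  interpret S: Vector_Spaces.linear scaleC scaleC "frame_op F" by (rule clinear_frame_op)
  have subK: "complex_vector.subspace (range K)" by (simp add: K.subspace_image)
  then have subSK: "complex_vector.subspace (frame_op F ` range K)" by (rule S.subspace_image)
  \<comment> \<open>The K-frame condition places \<open>range K\<close> inside
    \<open>range (synthesis F)\<close>, where \<open>frame_op F\<close> is injective; the span is
    the form required for the dimension formula.\<close>
  have inj: "inj_on (frame_op F) (complex_vector.span (range K))"
    using inj_on_frame_op[of F] frame subK
    by (auto simp: K_frame_def complex_vector.span_eq_iff[THEN iffD2] intro: inj_on_subset)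
  have dim_eq: "complex_vector.dim (frame_op F ` range K) = complex_vector.dim (range K)"
    using pair.dim_image_eq[OF clinear_frame_op inj] .
  have range_le: "range (synthesis F) \<subseteq> V" if "range F \<subseteq> V" "complex_vector.subspace V" for V
    using that by (auto simp: synthesis_def
        intro!: complex_vector.subspace_sum complex_vector.subspace_scale)
  \<comment> \<open>Here \<open>frame_op F\<close> takes values in the span of \<open>F\<close>,
    hence in \<open>range K\<close>, and equal dimensions turn the inclusion into equality.\<close>
  have "frame_op F ` range K = range K" if "range F \<subseteq> range K"
  proof (intro fd.subspace_dim_equal subSK subK)
    show "frame_op F ` range K \<subseteq> range K"
      using range_le[OF that subK] by (auto simp: frame_op_def)
  qed (simp add: dim_eq)
  moreover have "frame_op F ` range K = range K" if "range K \<subseteq> frame_op F ` range K"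
    using that by (intro fd.subspace_dim_equal[symmetric] subSK subK) (auto simp: dim_eq)
  \<comment> \<open>This reduces the second alternative of (ii) to the first: \<open>range K\<close>
    lies in the span of \<open>F\<close>.\<close>
  moreover have "range K \<subseteq> frame_op F ` range K" if "range F \<subseteq> frame_op F ` range K"
    using range_le[OF that subSK] frame by (auto simp: K_frame_def)
  \<comment> \<open>Rewriting with the invariance turns the projection target in (i) and the
    adjoint's domain in (ii) into \<open>range K\<close>.\<close>
  ultimately show ?thesis
    using canonical_K_dual_if_invariant[OF B(1,3) lin, of F] by auto
qed

end
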